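(* Let $C$ be a real symmetric positive semidefinite $n\times n$ matrix, with $r:=\operatorname{rank}(C)$ and $s\le r$. Then, for all factorizations $C=FF^\top$ (with $F\in\mathbb{R}^{n\times k}$, $r\le k\le n$), the factorization bound without side constraints satisfies $$z_{\mathrm{DFact}}(C,s,\cdot,\cdot\,;F)\le\sum_{\ell=1}^{s}\log\lambda_\ell(C).$$
   Context: Here $n>1$ and $0<s<n$ are integers. For a symmetric matrix $M$, $\lambda_\ell(M)$ is its $\ell$-th greatest eigenvalue (with multiplicity); $\operatorname{diag}(M)$ is the vector of diagonal entries of $M$; $\mathbf{e}$ is the all-ones vector; vector inequalities are componentwise. For a factorization $C=FF^\top$ with $F\in\mathbb{R}^{n\times k}$, $r\le k\le n$, the factorization bound without side constraints, $z_{\mathrm{DFact}}(C,s,\cdot,\cdot\,;F)$, is the optimal value (infimum, in the extended reals) of: minimize $$-\sum_{\ell=k-s+1}^{k}\log\lambda_\ell(\Theta)+\nu^\top\mathbf{e}+\tau s-s$$ over symmetric $\Theta\in\mathbb{R}^{k\times k}$, $\upsilon,\nu\in\mathbb{R}^n$, $\tau\in\mathbb{R}$, subject to $$\operatorname{diag}(F\Theta F^\top)+\upsilon-\nu-\tau\mathbf{e}=0,\qquad \Theta\succ0,\ \upsilon\ge0,\ \nu\ge0 .$$ *)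

theory Defs
  imports
    "Jordan_Normal_Form.Char_Poly"
    "Jordan_Normal_Form.DL_Rank"
    "HOL-Library.Extended_Real"
    Complex_Main
begin

definition symmetric_mat :: "real mat \<Rightarrow> bool" where
  "symmetric_mat M \<longleftrightarrow> square_mat M \<and> M\<^sup>T = M"

definition psd_mat :: "real mat \<Rightarrow> bool" where
  "psd_mat M \<longleftrightarrow> symmetric_mat M \<and> (\<forall>x \<in> carrier_vec (dim_row M). 0 \<le> x \<bullet> (M *\<^sub>v x))"

definition pd_mat :: "real mat \<Rightarrow> bool" where
  "pd_mat M \<longleftrightarrow> symmetric_mat M \<and>
     (\<forall>x \<in> carrier_vec (dim_row M). x \<noteq> 0\<^sub>v (dim_row M) \<longrightarrow> 0 < x \<bullet> (M *\<^sub>v x))"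

text \<open>The real eigenvalues of \<open>M\<close>, repeated according to algebraic multiplicity, in
  decreasing order. A symmetric matrix of order \<open>d\<close> has exactly \<open>d\<close> of them, and algebraic and
  geometric multiplicities agree.\<close>
definition eigvals_desc :: "real mat \<Rightarrow> real list" where
  "eigvals_desc M = rev (sorted_list_of_multiset (proots (char_poly M)))"

text \<open>The \<open>l\<close>-th greatest eigenvalue, with \<open>l\<close> counted from 1. It is meaningful only for
  symmetric \<open>M\<close> and \<open>1 \<le> l \<le> dim_row M\<close>.\<close>
definition eigval :: "nat \<Rightarrow> real mat \<Rightarrow> real" where
  "eigval l M = eigvals_desc M ! (l - 1)"

definition diag_vec :: "real mat \<Rightarrow> real vec" where
  "diag_vec M = vec (dim_row M) (\<lambda>i. M $$ (i, i))"

definition ones_vec :: "nat \<Rightarrow> real vec" where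
  "ones_vec n = vec n (\<lambda>_. 1)"

text \<open>The order on vectors is the componentwise one. The dimensions are \<open>n = dim_row C\<close> and
  \<open>k = dim_col F\<close>; apart from \<open>n\<close>, the problem depends on \<open>C\<close> only through the factor \<open>F\<close>,
  which is meant to satisfy \<open>C = F * F\<^sup>T\<close>.\<close>
definition dfact_feasible ::
  "real mat \<Rightarrow> real mat \<Rightarrow> (real mat \<times> real vec \<times> real vec \<times> real) set" where
  "dfact_feasible C F = (let n = dim_row C; k = dim_col F in
     {(\<Theta>, \<upsilon>, \<nu>, \<tau>).
        \<Theta> \<in> carrier_mat k k \<and> \<upsilon> \<in> carrier_vec n \<and> \<nu> \<in> carrier_vec n \<and>
        diag_vec (F * \<Theta> * F\<^sup>T) + \<upsilon> - \<nu> - \<tau> \<cdot>\<^sub>v ones_vec n = 0\<^sub>v n \<and>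
        pd_mat \<Theta> \<and> \<upsilon> \<ge> 0\<^sub>v n \<and> \<nu> \<ge> 0\<^sub>v n})"

definition dfact_objective ::
  "nat \<Rightarrow> real mat \<times> real vec \<times> real vec \<times> real \<Rightarrow> real" where
  "dfact_objective s = (\<lambda>(\<Theta>, \<upsilon>, \<nu>, \<tau>).
     let n = dim_vec \<nu>; k = dim_row \<Theta> in
       - (\<Sum>l = k - s + 1..k. ln (eigval l \<Theta>)) + \<nu> \<bullet> ones_vec n + \<tau> * real s - real s)"

text \<open>The infimum is taken in the extended reals. The truncated subtraction \<open>k - s\<close> in the
  objective agrees with the integer one whenever \<open>s \<le> k\<close>.\<close>
definition z_dfact :: "real mat \<Rightarrow> nat \<Rightarrow> real mat \<Rightarrow> ereal" where
  "z_dfact C s F = (INF p \<in> dfact_feasible C F. ereal (dfact_objective s p))"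

end

theory Submission
  imports Defs
begin

text \<open>
  Write \<open>F\<^sup>T F = U diag(g) U\<^sup>T\<close> with \<open>U\<close> orthogonal and \<open>g\<close> decreasing, and take
  \<open>\<Theta> = U diag(\<theta>) U\<^sup>T\<close> with \<open>\<theta>\<^sub>i = 1 / g\<^sub>i\<close> for \<open>i \<le> s\<close> and \<open>\<theta>\<^sub>i = 1 / g\<^sub>s\<close> for \<open>i > s\<close>. As
  \<open>\<theta>\<^sub>i g\<^sub>i \<le> 1\<close>, the matrix \<open>P = F \<Theta> F\<^sup>T\<close> satisfies \<open>P\<^sup>2 \<le> P\<close>, so its diagonal is at most 1 and
  \<open>(\<Theta>, e - diag P, 0, 1)\<close> is feasible. Its objective value is exactly \<open>ln g\<^sub>1 + ... + ln g\<^sub>s\<close>, and the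
  nonzero eigenvalues of \<open>F\<^sup>T F\<close> are those of \<open>F F\<^sup>T = C\<close>. The rank hypothesis gives \<open>g\<^sub>s > 0\<close>.
\<close>

section \<open>The real spectral theorem\<close>

text \<open>Write the eigenvector as v = x + i y with real \<open>x\<close> and \<open>y\<close>.
  The real and imaginary parts of A v = a v couple \<open>x\<close> and \<open>y\<close>, and the
  symmetry identity \<open>x \<bullet> (A *\<^sub>v y) = (A *\<^sub>v x) \<bullet> y\<close> then
  collapses to \<open>Im a * (x \<bullet> x + y \<bullet> y) = 0\<close>.\<close>

lemma Im_eigenvalue_of_real_symmetric:
  fixes A :: "real mat"
  assumes A: "A \<in> carrier_mat n n" and sym: "A\<^sup>T = A"
    and ev: "eigenvalue (map_mat complex_of_real A) a"
  shows "Im a = 0"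
proof -
  obtain v where v: "v \<in> carrier_vec n" and v0: "v \<noteq> 0\<^sub>v n"
    and Av: "map_mat complex_of_real A *\<^sub>v v = a \<cdot>\<^sub>v v"
    using ev A unfolding eigenvalue_def eigenvector_def by auto
  define x where "x = map_vec Re v"
  define y where "y = map_vec Im v"
  have x: "x \<in> carrier_vec n" and y: "y \<in> carrier_vec n"
    using v by (auto simp: x_def y_def)
  have entry: "(\<Sum>j = 0..<n. of_real (A $$ (i, j)) * v $ j) = a * v $ i" if i: "i < n" for i
  proof -
    have "(map_mat complex_of_real A *\<^sub>v v) $ i = (a \<cdot>\<^sub>v v) $ i" by (simp add: Av)
    then show ?thesis using A v i by (simp add: scalar_prod_def)
  qed
  have Ax: "A *\<^sub>v x = Re a \<cdot>\<^sub>v x - Im a \<cdot>\<^sub>v y"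
  proof (rule eq_vecI)
    fix i assume "i < dim_vec (Re a \<cdot>\<^sub>v x - Im a \<cdot>\<^sub>v y)"
    then have i: "i < n" using y by simp
    show "(A *\<^sub>v x) $ i = (Re a \<cdot>\<^sub>v x - Im a \<cdot>\<^sub>v y) $ i"
      using arg_cong[OF entry[OF i], of Re] A v i
      by (simp add: scalar_prod_def x_def y_def)
  qed (use A y in auto)
  have Ay: "A *\<^sub>v y = Re a \<cdot>\<^sub>v y + Im a \<cdot>\<^sub>v x"
  proof (rule eq_vecI)
    fix i assume "i < dim_vec (Re a \<cdot>\<^sub>v y + Im a \<cdot>\<^sub>v x)"
    then have i: "i < n" using x by simp
    show "(A *\<^sub>v y) $ i = (Re a \<cdot>\<^sub>v y + Im a \<cdot>\<^sub>v x) $ i"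
      using arg_cong[OF entry[OF i], of Im] A v i
      by (simp add: scalar_prod_def x_def y_def)
  qed (use A x in auto)
  have "x \<bullet> (A *\<^sub>v y) = (A *\<^sub>v x) \<bullet> y"
    using transpose_vec_mult_scalar[OF A y x] by (simp add: sym)
  then have "Im a * (x \<bullet> x + y \<bullet> y) = 0"
    unfolding Ax Ay using x y
    by (simp add: scalar_prod_add_distrib[of _ n] minus_scalar_prod_distrib[of _ n]
        comm_scalar_prod[of x n y] algebra_simps)
  moreover have "x \<bullet> x + y \<bullet> y \<noteq> 0"
  proof
    assume "x \<bullet> x + y \<bullet> y = 0"
    moreover have "0 \<le> x \<bullet> x" "0 \<le> y \<bullet> y"
      by (auto simp: scalar_prod_def intro!: sum_nonneg)
    ultimately have "x \<bullet> x = 0" "y \<bullet> y = 0" by linarith+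
    then have "x = 0\<^sub>v n" "y = 0\<^sub>v n"
      using conjugate_square_eq_0_vec[OF x] conjugate_square_eq_0_vec[OF y]
      by (auto simp: conjugate_vec_def)
    then have "v = 0\<^sub>v n"
      using v by (auto simp: x_def y_def vec_eq_iff complex_eq_iff)
    with v0 show False by simp
  qed
  ultimately show ?thesis by simp
qed

text \<open>The characteristic polynomial splits over the complex numbers, where all its roots are
  real. Embedding the reals is injective on coefficients, so the factorization descends.\<close>

lemma char_poly_symmetric_splits:
  fixes A :: "real mat"
  assumes A: "A \<in> carrier_mat n n" and sym: "A\<^sup>T = A"
  shows "\<exists>es. char_poly A = (\<Prod>e\<leftarrow>es. [:- e, 1:])"
proof -
  let ?A = "map_mat complex_of_real A"
  have cA: "?A \<in> carrier_mat n n" using A by simp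
  obtain as where as: "char_poly ?A = (\<Prod>a\<leftarrow>as. [:- a, 1:])"
    using char_poly_factorized[OF cA] by blast
  have "of_real (Re a) = a" if "a \<in> set as" for a
  proof -
    have "poly (char_poly ?A) a = 0"
      using that by (simp add: as poly_prod_list o_def prod_list_zero_iff image_iff)
    then have "eigenvalue ?A a" using eigenvalue_root_char_poly[OF cA] by simp
    then show ?thesis
      using Im_eigenvalue_of_real_symmetric[OF A sym] by (simp add: complex_eq_iff)
  qed
  then have "map_poly complex_of_real (\<Prod>e\<leftarrow>map Re as. [:- e, 1:]) = (\<Prod>a\<leftarrow>as. [:- a, 1:])"
  proof (induction as)
    case (Cons a as)
    interpret map_poly_comm_ring_hom complex_of_real ..
    have "map_poly complex_of_real [:- Re a, 1:] = [:- a, 1:]"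
      using Cons.prems[of a] by (simp add: map_poly_pCons)
    then show ?case using Cons by (simp add: hom_mult del: mult_pCons_left)
  qed simp
  then have "map_poly complex_of_real (char_poly A)
    = map_poly complex_of_real (\<Prod>e\<leftarrow>map Re as. [:- e, 1:])"
    using as of_real_hom.char_poly_hom[OF A, where ?'a = complex] by simp
  then have "char_poly A = (\<Prod>e\<leftarrow>map Re as. [:- e, 1:])"
    by (simp add: poly_eq_iff coeff_map_poly)
  then show ?thesis by blast
qed

text \<open>The Householder reflection along \<open>u - e\<^sub>0\<close>. If \<open>u = e\<^sub>0\<close>, then \<open>c = 2 / 0 = 0\<close> below and \<open>H\<close> is
  the identity.\<close>

lemma reflection_onto_unit_vec:
  fixes u :: "real vec"
  assumes u: "u \<in> carrier_vec n" and norm: "u \<bullet> u = 1" and n: "0 < n"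
  shows "\<exists>H \<in> carrier_mat n n. H\<^sup>T = H \<and> H * H = 1\<^sub>m n \<and> H *\<^sub>v unit_vec n 0 = u"
proof -
  define w where "w i = u $ i - (if i = 0 then 1 else 0)" for i
  define c where "c = 2 / (\<Sum>i = 0..<n. (w i)\<^sup>2)"
  define H where "H = mat n n (\<lambda>(i, j). (if i = j then 1 else 0) - c * w i * w j)"
  have H: "H \<in> carrier_mat n n" by (simp add: H_def)
  have uu: "(\<Sum>i = 0..<n. (u $ i)\<^sup>2) = 1"
    using norm u by (simp add: scalar_prod_def power2_eq_square)
  have "(\<Sum>i = 0..<n. (w i)\<^sup>2)
      = (\<Sum>i = 0..<n. (u $ i)\<^sup>2 + (if i = 0 then 1 - 2 * u $ i else 0))"
    by (intro sum.cong) (auto simp: w_def power2_eq_square algebra_simps)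
  \<comment> \<open>Because \<open>u\<close> has norm 1, |u - e_0|^2 = 2 - 2 u_0.\<close>
  then have ww: "(\<Sum>i = 0..<n. (w i)\<^sup>2) = - 2 * w 0"
    using n by (simp add: sum.distrib uu w_def)
  \<comment> \<open>This makes column 0 of \<open>H\<close> equal to e_0 + w = u. If
    \<open>w 0 = 0\<close>, then \<open>w\<close> vanishes altogether by \<open>ww\<close>.\<close>
  have cw: "c * w i * w 0 = - w i" if "i < n" for i
  proof (cases "w 0 = 0")
    case True
    then have "(w i)\<^sup>2 = 0"
      using ww that sum_nonneg_eq_0_iff[of "{0..<n}" "\<lambda>i. (w i)\<^sup>2"] by auto
    then show ?thesis by simp
  next
    case False
    then show ?thesis by (simp add: c_def ww)
  qed
  \<comment> \<open>True also for a vanishing sum, where \<open>c = 0\<close>. It lets the quadratic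
    term of \<open>H * H\<close> cancel the two linear ones.\<close>
  have cc: "c * c * (\<Sum>i = 0..<n. (w i)\<^sup>2) = 2 * c"
    by (simp add: c_def)
  have HH: "H * H = 1\<^sub>m n"
  proof (rule eq_matI)
    fix i j assume ij: "i < dim_row (1\<^sub>m n :: real mat)" "j < dim_col (1\<^sub>m n :: real mat)"
    have "(H * H) $$ (i, j) = (\<Sum>l = 0..<n. ((if i = l then 1 else 0) - c * w i * w l)
        * ((if l = j then 1 else 0) - c * w l * w j))"
      using ij by (simp add: H_def scalar_prod_def)
    also have "\<dots> = (\<Sum>l = 0..<n. (if l = i then (if i = j then 1 else 0) - c * w i * w j else 0)
        - (if l = j then c * w i * w j else 0) + c * c * w i * w j * (w l)\<^sup>2)"
      by (intro sum.cong) (auto simp: power2_eq_square algebra_simps)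
    also have "\<dots> = (if i = j then 1 else 0) - 2 * (c * w i * w j)
        + w i * w j * (c * c * (\<Sum>l = 0..<n. (w l)\<^sup>2))"
      using ij by (simp add: sum.distrib sum_subtractf sum_distrib_left algebra_simps)
    also have "\<dots> = (if i = j then 1 else 0)" unfolding cc by simp
    finally show "(H * H) $$ (i, j) = (1\<^sub>m n :: real mat) $$ (i, j)" using ij by simp
  qed (auto simp: H_def)
  have "H *\<^sub>v unit_vec n 0 = u"
  proof (rule eq_vecI)
    fix i assume "i < dim_vec u"
    then have i: "i < n" using u by simp
    have "(H *\<^sub>v unit_vec n 0) $ i = H $$ (i, 0)"
      using i n by (simp add: H_def)
    also have "\<dots> = u $ i" using i n cw[OF i] by (simp add: H_def w_def)
    finally show "(H *\<^sub>v unit_vec n 0) $ i = u $ i" .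
  qed (use u in \<open>auto simp: H_def\<close>)
  moreover have "H\<^sup>T = H" by (auto simp: H_def mat_eq_iff)
  ultimately show ?thesis using H HH by blast
qed

section \<open>Matrices of the form U diag(f) U^T\<close>

definition orth_conj :: "real mat \<Rightarrow> (nat \<Rightarrow> real) \<Rightarrow> real mat" where
  "orth_conj U f = U * mat_diag (dim_col U) f * U\<^sup>T"

lemma orth_conj_carrier [simp]: "U \<in> carrier_mat n k \<Longrightarrow> orth_conj U f \<in> carrier_mat n n"
  unfolding orth_conj_def by (auto intro!: mult_carrier_mat[of _ n k])

lemma orth_conj_index:
  assumes "U \<in> carrier_mat n k" "i < n" "j < n"
  shows "orth_conj U f $$ (i, j) = (\<Sum>l<k. U $$ (i, l) * f l * U $$ (j, l))"
  using assms
  by (simp add: orth_conj_def mat_diag_mult_right[of _ n k] scalar_prod_def lessThan_atLeast0)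

lemma orth_conj_transpose:
  assumes "U \<in> carrier_mat n k"
  shows "(orth_conj U f)\<^sup>T = orth_conj U f"
proof -
  have "dim_row (orth_conj U f) = n" "dim_col (orth_conj U f) = n"
    using orth_conj_carrier[OF assms] by (blast dest: carrier_matD)+
  then show ?thesis
    by (intro eq_matI) (auto simp: orth_conj_index[OF assms] mult_ac)
qed

text \<open>The inner factor U^T U cancels, so matrices sharing \<open>U\<close> multiply through
  their diagonals.\<close>

lemma orth_conj_mult:
  assumes U: "U \<in> carrier_mat n k" and orth: "U\<^sup>T * U = 1\<^sub>m k"
  shows "orth_conj U f * orth_conj U g = orth_conj U (\<lambda>i. f i * g i)"
proof -
  have k: "dim_col U = k" and Ut: "U\<^sup>T \<in> carrier_mat k n" using U by auto
  note D = mat_diag_dim[of k]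
  have "orth_conj U f * orth_conj U g
    = U * mat_diag k f * ((U\<^sup>T * U) * (mat_diag k g * U\<^sup>T))"
    unfolding orth_conj_def k
    by (simp add: assoc_mult_mat[of _ n k _ k _ n] assoc_mult_mat[of _ n k _ n _ n]
        assoc_mult_mat[of _ k n _ k _ n] mult_carrier_mat[OF D Ut] mult_carrier_mat[OF U D]
        assoc_mult_mat[of _ k k _ n _ n] mult_carrier_mat[OF U mult_carrier_mat[OF D Ut]]
        mult_carrier_mat[OF Ut mult_carrier_mat[OF U mult_carrier_mat[OF D Ut]]] U Ut)
  also have "\<dots> = U * (mat_diag k f * mat_diag k g) * U\<^sup>T"
    unfolding orth
    by (simp add: assoc_mult_mat[of _ n k _ k _ n] assoc_mult_mat[of _ k k _ k _ n]
       mult_carrier_mat[OF D Ut] mult_carrier_mat[OF U D] mult_carrier_mat[OF D D] U Ut left_mult_one_mat[of _ k n]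
       del: mat_diag_diag)
  finally show ?thesis by (simp add: orth_conj_def k)
qed

text \<open>Moving the outer \<open>U\<close> across the inner product leaves a diagonal form in the
  coordinates U^T x.\<close>

lemma orth_conj_quadratic_form:
  assumes U: "U \<in> carrier_mat n k" and x: "x \<in> carrier_vec n"
  shows "x \<bullet> (orth_conj U f *\<^sub>v x) = (\<Sum>i<k. f i * ((U\<^sup>T *\<^sub>v x) $ i)\<^sup>2)"
proof -
  have k: "dim_col U = k" and Ut: "U\<^sup>T \<in> carrier_mat k n" using U by auto
  have y: "U\<^sup>T *\<^sub>v x \<in> carrier_vec k" using Ut x by simp
  have diag: "(mat_diag k f *\<^sub>v (U\<^sup>T *\<^sub>v x)) $ i = f i * (U\<^sup>T *\<^sub>v x) $ i" if "i < k" for i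
  proof -
    have "(mat_diag k f *\<^sub>v (U\<^sup>T *\<^sub>v x)) $ i
      = (\<Sum>j = 0..<k. (if i = j then f j else 0) * (U\<^sup>T *\<^sub>v x) $ j)"
      using that y U by (simp add: mat_diag_def scalar_prod_def)
    also have "\<dots> = (\<Sum>j = 0..<k. if j = i then f i * (U\<^sup>T *\<^sub>v x) $ i else 0)"
      by (intro sum.cong) auto
    finally show ?thesis using that by simp
  qed
  have Dy: "mat_diag k f *\<^sub>v (U\<^sup>T *\<^sub>v x) \<in> carrier_vec k"
    by (rule mult_mat_vec_carrier[OF mat_diag_dim y])
  have "orth_conj U f *\<^sub>v x = U *\<^sub>v (mat_diag k f *\<^sub>v (U\<^sup>T *\<^sub>v x))"
    unfolding orth_conj_def k
    using U Ut x y assoc_mult_mat_vec[of "U * mat_diag k f" n k "U\<^sup>T" n x]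
      assoc_mult_mat_vec[of U n k "mat_diag k f" k "U\<^sup>T *\<^sub>v x"]
    by (simp add: mult_carrier_mat[of U n k])
  then have "x \<bullet> (orth_conj U f *\<^sub>v x) = (U\<^sup>T *\<^sub>v x) \<bullet> (mat_diag k f *\<^sub>v (U\<^sup>T *\<^sub>v x))"
    using transpose_vec_mult_scalar[OF U Dy x] by simp
  also have "\<dots> = (\<Sum>i<k. f i * ((U\<^sup>T *\<^sub>v x) $ i)\<^sup>2)"
    unfolding scalar_prod_def using carrier_vecD[OF Dy]
    by (auto simp: lessThan_atLeast0 diag power2_eq_square mult_ac
      simp del: index_mult_mat_vec dim_mult_mat_vec intro!: sum.cong)
  finally show ?thesis .
qed

lemma char_poly_orth_conj:
  assumes U: "U \<in> carrier_mat n n" and orth: "U\<^sup>T * U = 1\<^sub>m n" "U * U\<^sup>T = 1\<^sub>m n"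
  shows "char_poly (orth_conj U f) = (\<Prod>e\<leftarrow>map f [0..<n]. [:- e, 1:])"
proof -
  have "similar_mat (orth_conj U f) (mat_diag n f)"
    by (rule similar_matI[of _ _ U "U\<^sup>T" n]) (use U orth in \<open>auto simp: orth_conj_def\<close>)
  then have "char_poly (orth_conj U f) = char_poly (mat_diag n f)" by (rule char_poly_similar)
  also have "\<dots> = (\<Prod>e\<leftarrow>diag_mat (mat_diag n f). [:- e, 1:])"
    by (rule char_poly_upper_triangular[of _ n]) (auto simp: mat_diag_def upper_triangular_def)
  also have "diag_mat (mat_diag n f) = map f [0..<n]"
    by (simp add: diag_mat_def mat_diag_def)
  finally show ?thesis .
qed

lemma real_spectral_theorem:
  fixes A :: "real mat"
  assumes "A \<in> carrier_mat n n" and "A\<^sup>T = A" and "char_poly A = (\<Prod>e\<leftarrow>es. [:- e, 1:])"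
  shows "\<exists>U \<in> carrier_mat n n. U\<^sup>T * U = 1\<^sub>m n \<and> U * U\<^sup>T = 1\<^sub>m n \<and> A = orth_conj U ((!) es)"
  using assms
proof (induction es arbitrary: n A)
  case Nil
  then have "n = 0" using degree_monic_char_poly[of A n] by simp
  then show ?case using Nil.prems(1)
    by (intro bexI[of _ "1\<^sub>m 0"]) (auto simp: orth_conj_def mat_eq_iff)
next
  case (Cons e es)
  note A = Cons.prems(1) and sym = Cons.prems(2) and cp = Cons.prems(3)
  have "degree (char_poly A) = Suc (length es)"
    unfolding cp using degree_linear_factors[of uminus "e # es"] by simp
  then have n: "n = Suc (length es)" using degree_monic_char_poly[OF A] by simp
  define m where "m = length es"
  have nm: "n = 1 + m" by (simp add: n m_def)
  have "poly (char_poly A) e = 0" by (simp add: cp)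
  then have "eigenvalue A e" using eigenvalue_root_char_poly[OF A] by simp
  then obtain v where v: "v \<in> carrier_vec n" "v \<noteq> 0\<^sub>v n" and Av: "A *\<^sub>v v = e \<cdot>\<^sub>v v"
    using A unfolding eigenvalue_def eigenvector_def by auto
  have vv: "v \<bullet> v > 0"
    using conjugate_square_greater_0_vec[OF v(1)] v(2) by (simp add: conjugate_vec_def)
  define u where "u = (1 / sqrt (v \<bullet> v)) \<cdot>\<^sub>v v"
  have u: "u \<in> carrier_vec n" using v by (simp add: u_def)
  have uu: "u \<bullet> u = 1" using vv v(1) by (simp add: u_def)
  have Au: "A *\<^sub>v u = e \<cdot>\<^sub>v u"
    using A v Av by (simp add: u_def mult_mat_vec smult_smult_assoc mult.commute)
  obtain H where H: "H \<in> carrier_mat n n" and Ht: "H\<^sup>T = H" and HH: "H * H = 1\<^sub>m n"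
    and Hu: "H *\<^sub>v unit_vec n 0 = u"
    using reflection_onto_unit_vec[OF u uu] n by auto
  \<comment> \<open>\<open>H\<close> is its own inverse, so \<open>B\<close> is similar to
    \<open>A\<close>. It has e_0 as an eigenvector, which fixes column 0, and its symmetry fixes row
    0.\<close>
  define B where "B = H * A * H"
  have B: "B \<in> carrier_mat n n" using H A by (simp add: B_def)
  have Bt: "B\<^sup>T = B"
    using H A by (simp add: B_def transpose_mult[of H n n "A * H" n] transpose_mult[of A n n H n] Ht sym)
  have AB: "A = H * B * H"
  proof -
    have "H * B * H = (H * H) * A * (H * H)"
      using H A by (simp add: B_def mult_carrier_mat[of _ n n _ n] assoc_mult_mat[of _ n n _ n _ n])
    then show ?thesis using A by (simp add: HH)
  qed
  have "H *\<^sub>v u = unit_vec n 0"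
    using assoc_mult_mat_vec[OF H H, of "unit_vec n 0"] by (simp add: HH Hu)
  then have B0: "B *\<^sub>v unit_vec n 0 = e \<cdot>\<^sub>v unit_vec n 0"
    using H A u assoc_mult_mat_vec[of H n n "A * H" n "unit_vec n 0"]
      assoc_mult_mat_vec[of A n n H n "unit_vec n 0"]
    by (simp add: B_def Hu Au mult_mat_vec)
  have col0: "B $$ (i, 0) = (if i = 0 then e else 0)" if "i < n" for i
    using arg_cong[OF B0, of "\<lambda>w. w $ i"] that B n by simp
  have row0: "B $$ (0, i) = (if i = 0 then e else 0)" if "i < n" for i
    using col0[OF that] arg_cong[OF Bt, of "\<lambda>M. M $$ (0, i)"] that B n by simp
  define A' where "A' = mat m m (\<lambda>(i, j). B $$ (Suc i, Suc j))"
  define E where "E = mat 1 1 (\<lambda>_. e)"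
  have A': "A' \<in> carrier_mat m m" and E: "E \<in> carrier_mat 1 1" by (auto simp: A'_def E_def)
  have block: "B = four_block_mat E (0\<^sub>m 1 m) (0\<^sub>m m 1) A'"
    using B by (intro eq_matI) (auto simp: E_def A'_def nm col0 row0)
  have "similar_mat A B"
    by (rule similar_matI[of _ _ H H n]) (use A B H HH AB in auto)
  then have "char_poly A = char_poly B" by (rule char_poly_similar)
  also have "\<dots> = char_poly E * char_poly A'"
    unfolding block by (rule char_poly_four_block_zeros_col[OF E _ A']) auto
  also have "char_poly E = [:- e, 1:]"
    using char_poly_upper_triangular[OF E] by (simp add: E_def diag_mat_def upper_triangular_def)
  \<comment> \<open>Cancelling the first linear factor leaves exactly the roots \<open>es\<close>
    for the smaller block, as the induction hypothesis requires.\<close>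
  finally have "[:- e, 1:] * char_poly A' = [:- e, 1:] * (\<Prod>e\<leftarrow>es. [:- e, 1:])"
    using cp by (simp del: mult_pCons_left)
  then have cp': "char_poly A' = (\<Prod>e\<leftarrow>es. [:- e, 1:])"
    by (subst (asm) mult_cancel_left) simp
  have "A'\<^sup>T = A'"
  proof (rule eq_matI)
    fix i j assume "i < dim_row A'" "j < dim_col A'"
    then show "A'\<^sup>T $$ (i, j) = A' $$ (i, j)"
      using arg_cong[OF Bt, of "\<lambda>M. M $$ (Suc i, Suc j)"] B by (simp add: A'_def nm)
  qed (simp_all add: A'_def)
  from Cons.IH[OF A' this cp'] obtain U where U: "U \<in> carrier_mat m m"
    and orth: "U\<^sup>T * U = 1\<^sub>m m" "U * U\<^sup>T = 1\<^sub>m m" and AU: "A' = orth_conj U ((!) es)" by blast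
  \<comment> \<open>\<open>V\<close> fixes e_0 and acts as \<open>U\<close> on the other
    coordinates. It diagonalizes \<open>B\<close>, hence \<open>H * V\<close> diagonalizes
    \<open>A\<close>.\<close>
  define V where "V = four_block_mat (1\<^sub>m 1) (0\<^sub>m 1 m) (0\<^sub>m m 1) U"
  have V: "V \<in> carrier_mat n n" using U by (auto simp: V_def nm)
  have Vt: "V\<^sup>T = four_block_mat (1\<^sub>m 1) (0\<^sub>m 1 m) (0\<^sub>m m 1) U\<^sup>T"
    using U by (simp add: V_def transpose_four_block_mat[of _ 1 1 _ m _ m])
  note mult_block = mult_four_block_mat[of _ 1 1 _ m _ m _ _ 1 _ m]
  have VV: "V\<^sup>T * V = 1\<^sub>m n" "V * V\<^sup>T = 1\<^sub>m n"
    unfolding V_def Vt[unfolded V_def] using U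
    by (simp_all add: mult_block orth nm)
  have "mat_diag n ((!) (e # es)) = four_block_mat E (0\<^sub>m 1 m) (0\<^sub>m m 1) (mat_diag m ((!) es))"
    by (intro eq_matI) (auto simp: mat_diag_def E_def nm nth_Cons')
  then have BV: "B = V * mat_diag n ((!) (e # es)) * V\<^sup>T"
    unfolding V_def Vt[unfolded V_def] block AU orth_conj_def using U E
    by (simp add: mult_block mult_carrier_mat[of _ m m] left_mult_zero_mat[OF mat_diag_dim]
        right_mult_zero_mat[OF mult_carrier_mat[OF U mat_diag_dim]])
  note assoc = assoc_mult_mat[of _ n n _ n _ n] mult_carrier_mat[of _ n n _ n]
  have Vt': "V\<^sup>T \<in> carrier_mat n n" using V by simp
  have HVt: "(H * V)\<^sup>T = V\<^sup>T * H" using H V by (simp add: transpose_mult[of _ n n] Ht)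
  have "(H * V)\<^sup>T * (H * V) = V\<^sup>T * ((H * H) * V)"
    unfolding HVt using H V Vt' by (simp add: assoc)
  then have 1: "(H * V)\<^sup>T * (H * V) = 1\<^sub>m n" using V by (simp add: HH VV)
  have "H * V * (H * V)\<^sup>T = H * ((V * V\<^sup>T) * H)"
    unfolding HVt using H V Vt' by (simp add: assoc)
  then have 2: "H * V * (H * V)\<^sup>T = 1\<^sub>m n" using H by (simp add: HH VV)
  have "A = orth_conj (H * V) ((!) (e # es))"
    unfolding orth_conj_def HVt using H V Vt' by (subst AB, subst BV) (simp add: assoc)
  then show ?case using 1 2 H V by (intro bexI[of _ "H * V"]) auto
qed

section \<open>Characteristic polynomial and rank\<close>

text \<open>The zero block survives in the characteristic matrix, whose determinant therefore
  factors.\<close>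

lemma char_poly_four_block_lower:
  fixes A D :: "'a :: idom mat"
  assumes A: "A \<in> carrier_mat n n" and C: "C \<in> carrier_mat m n" and D: "D \<in> carrier_mat m m"
  shows "char_poly (four_block_mat A (0\<^sub>m n m) C D) = char_poly A * char_poly D"
proof -
  have "char_poly_matrix (four_block_mat A (0\<^sub>m n m) C D)
    = four_block_mat (char_poly_matrix A) (0\<^sub>m n m) (map_mat (\<lambda>a. [:- a:]) C) (char_poly_matrix D)"
    by (rule eq_matI) (use A C D in \<open>auto simp: char_poly_matrix_def one_poly_def\<close>)
  then show ?thesis
    unfolding char_poly_def
    using det_four_block_mat_upper_right_zero[of "char_poly_matrix A" n _ m
        "map_mat (\<lambda>a. [:- a:]) C" "char_poly_matrix D"] A C D by simp
qed

lemma char_poly_zero_mat: "char_poly (0\<^sub>m n n :: 'a :: idom mat) = [:0, 1:] ^ n"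
proof -
  have "char_poly (0\<^sub>m n n :: 'a mat) = (\<Prod>a\<leftarrow>diag_mat (0\<^sub>m n n). [:- a, 1:])"
    by (rule char_poly_upper_triangular[of _ n]) auto
  also have "diag_mat (0\<^sub>m n n :: 'a mat) = replicate n 0"
    by (auto simp: diag_mat_def list_eq_iff_nth_eq)
  finally show ?thesis by (simp add: prod_list_replicate)
qed

text \<open>Sylvester's identity. Conjugation by the unipotent \<open>?P\<close> turns
  \<open>?Y\<close>, with diagonal blocks 0 and \<open>G * F\<close>, into \<open>?X\<close>, with
  diagonal blocks \<open>F * G\<close> and 0. The powers of the variable come from the zero
  blocks.\<close>

lemma char_poly_mult_commute:
  fixes F G :: "'a :: idom mat"
  assumes F: "F \<in> carrier_mat n k" and G: "G \<in> carrier_mat k n"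
  shows "char_poly (F * G) * [:0, 1:] ^ k = [:0, 1:] ^ n * char_poly (G * F)"
proof -
  let ?X = "four_block_mat (F * G) (0\<^sub>m n k) G (0\<^sub>m k k)"
  let ?Y = "four_block_mat (0\<^sub>m n n) (0\<^sub>m n k) G (G * F)"
  let ?P = "four_block_mat (1\<^sub>m n) F (0\<^sub>m k n) (1\<^sub>m k)"
  let ?Q = "four_block_mat (1\<^sub>m n) (- F) (0\<^sub>m k n) (1\<^sub>m k)"
  note mult_block = mult_four_block_mat[of _ n n _ k _ k _ _ n _ k]
  have FG: "F * G \<in> carrier_mat n n" and GF: "G * F \<in> carrier_mat k k" using F G by auto
  have PQ: "?P * ?Q = 1\<^sub>m (n + k)" "?Q * ?P = 1\<^sub>m (n + k)"
  proof -
    have "- 0\<^sub>m k k + 1\<^sub>m k = (1\<^sub>m k :: 'a mat)" "F + - F = 0\<^sub>m n k" "- F + F = 0\<^sub>m n k"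
      using F by (auto simp: mat_eq_iff)
    then show "?P * ?Q = 1\<^sub>m (n + k)" "?Q * ?P = 1\<^sub>m (n + k)"
      using F by (simp_all add: mult_block)
  qed
  have "?P * ?Y * ?Q = ?X"
    using F G FG GF
    by (simp add: mult_block uminus_l_inv_mat[of _ n k] uminus_l_inv_mat[of _ k k]
        mult_carrier_mat[of _ n k _ k])
  then have "similar_mat ?X ?Y"
    by (intro similar_matI[of _ _ ?P ?Q "n + k"]) (use F G FG GF PQ in auto)
  then have "char_poly ?X = char_poly ?Y" by (rule char_poly_similar)
  then show ?thesis
    by (simp add: char_poly_four_block_lower[OF FG G] char_poly_four_block_lower[OF _ G GF]
        char_poly_zero_mat)
qed

text \<open>Each summand is an outer product of rank at most one, and rank is subadditive.\<close>

lemma rank_sum_rank_one_le: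
  fixes f h :: "nat \<Rightarrow> nat \<Rightarrow> 'a :: field"
  shows "vec_space.rank n (mat n nc (\<lambda>(a, b). \<Sum>i<m. f i a * h i b)) \<le> m"
proof (induction m)
  case 0
  interpret vec_space "TYPE('a)" n .
  have "mat n nc (\<lambda>(a, b). \<Sum>i<(0::nat). f i a * h i b) = 0\<^sub>m n nc" by (auto simp: mat_eq_iff)
  then show ?case using rank_0I[of nc] by (simp only: order_refl)
next
  case (Suc m)
  interpret vec_space "TYPE('a)" n .
  let ?A = "mat n nc (\<lambda>(a, b). \<Sum>i<m. f i a * h i b)"
  let ?B = "mat n nc (\<lambda>(a, b). f m a * h m b)"
  have "mat n nc (\<lambda>(a, b). \<Sum>i<Suc m. f i a * h i b) = ?A + ?B" by (auto simp: mat_eq_iff)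
  moreover have "rank ?B \<le> 1" by (rule rank_le_1_product_entries[of _ nc "f m" "h m"]) auto
  moreover have "rank (?A + ?B) \<le> rank ?A + rank ?B" by (rule rank_subadditive[of _ nc]) auto
  ultimately show ?case using Suc.IH by simp
qed

section \<open>Ordered eigenvalues\<close>

lemma proots_linear_factors:
  "proots (\<Prod>e\<leftarrow>es. [:- e, 1:]) = mset (es :: 'a :: idom list)"
proof (induction es)
  case (Cons e es)
  have "(\<Prod>e\<leftarrow>es. [:- e, 1:]) \<noteq> 0" by (auto simp: prod_list_zero_iff)
  then show ?case using Cons by (simp add: proots_mult del: mult_pCons_left)
qed simp

lemma eigvals_desc_eqI:
  assumes "proots (char_poly M) = mset es" and "sorted (rev es)"
  shows "eigvals_desc M = es"
proof -
  have "sort es = rev es" using assms(2) by (intro properties_for_sort) auto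
  then show ?thesis by (simp add: eigvals_desc_def assms(1) sorted_list_of_multiset_mset)
qed

lemma mset_eigvals_desc: "mset (eigvals_desc M) = proots (char_poly M)"
  by (simp add: eigvals_desc_def)

lemma sorted_rev_eigvals_desc: "sorted (rev (eigvals_desc M))"
  by (simp add: eigvals_desc_def)

text \<open>\<open>eigvals_desc\<close> collects real roots only; they exhaust the polynomial
  because that of a symmetric matrix splits over the reals.\<close>

lemma char_poly_eigvals_desc:
  assumes A: "A \<in> carrier_mat n n" and sym: "A\<^sup>T = A"
  shows "char_poly A = (\<Prod>e\<leftarrow>eigvals_desc A. [:- e, 1:])"
proof -
  obtain es where es: "char_poly A = (\<Prod>e\<leftarrow>es. [:- e, 1:])"
    using char_poly_symmetric_splits[OF A sym] by blast
  then have "mset (eigvals_desc A) = mset es" by (simp add: mset_eigvals_desc proots_linear_factors)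
  then have "mset (map (\<lambda>e. [:- e, 1:]) (eigvals_desc A)) = mset (map (\<lambda>e. [:- e, 1:]) es)" by simp
  then show ?thesis unfolding es by (metis prod_mset_prod_list)
qed

lemma length_eigvals_desc:
  assumes A: "A \<in> carrier_mat n n" and sym: "A\<^sup>T = A"
  shows "length (eigvals_desc A) = n"
  using degree_monic_char_poly[OF A] degree_linear_factors[of uminus "eigvals_desc A"]
  by (simp add: char_poly_eigvals_desc[OF A sym])

text \<open>On an eigenvector \<open>v\<close> the quadratic form equals
  \<open>e * (v \<bullet> v)\<close>, where \<open>v \<bullet> v\<close> is positive.\<close>

lemma eigvals_desc_nonneg:
  assumes A: "A \<in> carrier_mat n n" and sym: "A\<^sup>T = A"
    and psd: "\<And>x. x \<in> carrier_vec n \<Longrightarrow> 0 \<le> x \<bullet> (A *\<^sub>v x)"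
    and e: "e \<in> set (eigvals_desc A)"
  shows "0 \<le> e"
proof -
  have "poly (char_poly A) e = 0"
    using e by (simp add: char_poly_eigvals_desc[OF A sym] poly_prod_list prod_list_zero_iff o_def image_iff)
  then have "eigenvalue A e" using eigenvalue_root_char_poly[OF A] by simp
  then obtain v where v: "v \<in> carrier_vec n" "v \<noteq> 0\<^sub>v n" and Av: "A *\<^sub>v v = e \<cdot>\<^sub>v v"
    using A unfolding eigenvalue_def eigenvector_def by auto
  have "v \<bullet> v > 0"
    using conjugate_square_greater_0_vec[OF v(1)] v(2) by (simp add: conjugate_vec_def)
  moreover have "0 \<le> e * (v \<bullet> v)" using psd[OF v(1)] v(1) by (simp add: Av)
  ultimately show ?thesis by (simp add: zero_le_mult_iff)
qed

text \<open>Only the first \<open>m\<close> outer products of the spectral decomposition survive. In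
  the main proof this turns the rank hypothesis into positivity of an eigenvalue.\<close>

lemma rank_symmetric_le:
  assumes A: "A \<in> carrier_mat n n" and sym: "A\<^sup>T = A"
    and zero: "\<And>i. m \<le> i \<Longrightarrow> i < n \<Longrightarrow> eigvals_desc A ! i = 0"
  shows "vec_space.rank n A \<le> m"
proof -
  let ?e = "eigvals_desc A"
  obtain U where U: "U \<in> carrier_mat n n" and AU: "A = orth_conj U ((!) ?e)"
    using real_spectral_theorem[OF A sym char_poly_eigvals_desc[OF A sym]] by blast
  \<comment> \<open>The list has length \<open>n\<close> while \<open>m\<close> may be larger, so
    the number of summands is capped.\<close>
  define m' where "m' = min m n"
  have "A = mat n n (\<lambda>(a, b). \<Sum>i<m'. (U $$ (a, i) * ?e ! i) * U $$ (b, i))"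
  proof (rule eq_matI)
    fix a b assume "a < dim_row (mat n n (\<lambda>(a, b). \<Sum>i<m'. (U $$ (a, i) * ?e ! i) * U $$ (b, i)))"
      "b < dim_col (mat n n (\<lambda>(a, b). \<Sum>i<m'. (U $$ (a, i) * ?e ! i) * U $$ (b, i)))"
    then have ab: "a < n" "b < n" by auto
    have "A $$ (a, b) = (\<Sum>i<n. U $$ (a, i) * ?e ! i * U $$ (b, i))"
      by (subst AU) (rule orth_conj_index[OF U ab])
    also have "\<dots> = (\<Sum>i<m'. U $$ (a, i) * ?e ! i * U $$ (b, i))"
      by (rule sum.mono_neutral_right) (auto simp: m'_def zero)
    finally show "A $$ (a, b) = mat n n (\<lambda>(a, b). \<Sum>i<m'. (U $$ (a, i) * ?e ! i) * U $$ (b, i)) $$ (a, b)"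
      using ab by simp
  qed (use A in auto)
  then have "vec_space.rank n A \<le> m'"
    using rank_sum_rank_one_le[of n n "\<lambda>i a. U $$ (a, i) * ?e ! i" "\<lambda>i b. U $$ (b, i)" m']
    by simp
  then show ?thesis by (simp add: m'_def)
qed

section \<open>Spectra of F^T F and F F^T\<close>

lemma gram_quadratic_form:
  fixes F :: "real mat"
  assumes F: "F \<in> carrier_mat n k" and x: "x \<in> carrier_vec k"
  shows "x \<bullet> (F\<^sup>T * F *\<^sub>v x) = (F *\<^sub>v x) \<bullet> (F *\<^sub>v x)"
proof -
  have Fx: "F *\<^sub>v x \<in> carrier_vec n" using F x by simp
  have "x \<bullet> (F\<^sup>T * F *\<^sub>v x) = x \<bullet> (F\<^sup>T *\<^sub>v (F *\<^sub>v x))" using F x by simp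
  also have "\<dots> = (F\<^sup>T *\<^sub>v (F *\<^sub>v x)) \<bullet> x"
    using F x by (intro comm_scalar_prod[of _ k]) auto
  also have "\<dots> = (F *\<^sub>v x) \<bullet> (F *\<^sub>v x)" by (rule transpose_vec_mult_scalar[OF F x Fx])
  finally show ?thesis .
qed

text \<open>By Sylvester's identity, adding \<open>k\<close> zeros to the spectrum of F F^T gives
  the same multiset as adding \<open>n\<close> zeros to that of F^T F. The eigenvalues of F^T F are
  nonnegative, so the surplus zeros come last in decreasing order.\<close>

lemma eigvals_desc_gram:
  fixes F :: "real mat"
  assumes F: "F \<in> carrier_mat n k" and k: "k \<le> n"
  shows "eigvals_desc (F * F\<^sup>T) = eigvals_desc (F\<^sup>T * F) @ replicate (n - k) 0"
proof -
  let ?C = "F * F\<^sup>T" and ?G = "F\<^sup>T * F"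
  have C: "?C \<in> carrier_mat n n" and G: "?G \<in> carrier_mat k k" using F by auto
  have Gt: "?G\<^sup>T = ?G" using F by (simp add: transpose_mult[of _ k n])
  have nonneg: "0 \<le> e" if "e \<in> set (eigvals_desc ?G)" for e
  proof (rule eigvals_desc_nonneg[OF G Gt _ that])
    fix x :: "real vec" assume "x \<in> carrier_vec k"
    then show "0 \<le> x \<bullet> (?G *\<^sub>v x)"
      by (simp only: gram_quadratic_form[OF F]) (simp add: scalar_prod_def sum_nonneg)
  qed
  have "monic (char_poly ?C)" "monic (char_poly ?G)"
    using degree_monic_char_poly[OF C] degree_monic_char_poly[OF G] by auto
  then have nz: "char_poly ?C \<noteq> 0" "char_poly ?G \<noteq> 0" by auto
  have x: "proots ([:0, 1:] :: real poly) = {#0#}" using proots_linear_factor[of 0] by simp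
  have "proots (char_poly ?C * [:0, 1:] ^ k) = proots ([:0, 1:] ^ n * char_poly ?G)"
    using char_poly_mult_commute[of F n k "F\<^sup>T"] F by simp
  then have "proots (char_poly ?C) + replicate_mset k 0 = replicate_mset n 0 + proots (char_poly ?G)"
    using nz by (simp add: proots_mult proots_power x)
  also have "replicate_mset n (0 :: real) = replicate_mset (n - k) 0 + replicate_mset k 0"
    using k by (intro multiset_eqI) simp
  finally have "proots (char_poly ?C) = mset (eigvals_desc ?G @ replicate (n - k) 0)"
    by (simp add: mset_eigvals_desc)
  moreover have "sorted (rev (eigvals_desc ?G @ replicate (n - k) 0))"
    using nonneg by (auto simp: sorted_append sorted_rev_eigvals_desc)
  ultimately show ?thesis by (rule eigvals_desc_eqI)
qed

section \<open>The factorization bound\<close>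

text \<open>For \<open>P = F \<Theta> F\<^sup>T\<close> and \<open>q = P e\<^sub>i\<close>: \<open>(P\<^sub>i\<^sub>i)\<^sup>2 \<le> q \<bullet> q \<le> P\<^sub>i\<^sub>i\<close>.\<close>

lemma diag_congruence_le_1:
  fixes F :: "real mat"
  assumes F: "F \<in> carrier_mat n k" and U: "U \<in> carrier_mat k k" and orth: "U\<^sup>T * U = 1\<^sub>m k"
    and G: "F\<^sup>T * F = orth_conj U g"
    and bound: "\<And>j. j < k \<Longrightarrow> 0 \<le> \<theta> j \<and> \<theta> j * g j \<le> 1" and i: "i < n"
  shows "(F * orth_conj U \<theta> * F\<^sup>T) $$ (i, i) \<le> 1"
proof -
  let ?T = "orth_conj U \<theta>" and ?G = "orth_conj U g"
  \<comment> \<open>\<open>y\<close> is F^T e_i, so \<open>q\<close> is column \<open>i\<close> of P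
    and \<open>q $ i\<close> is the diagonal entry in question.\<close>
  define y where "y = row F i"
  define q where "q = F *\<^sub>v (?T *\<^sub>v y)"
  have y: "y \<in> carrier_vec k" using F by (auto simp: y_def intro!: carrier_vecI)
  have T: "?T \<in> carrier_mat k k" and Gc: "?G \<in> carrier_mat k k" using U by auto
  have Ty: "?T *\<^sub>v y \<in> carrier_vec k" using T y by simp
  have q: "q \<in> carrier_vec n" using F Ty by (simp add: q_def)
  have "(F * ?T * F\<^sup>T) $$ (i, i) = (F * (?T * F\<^sup>T)) $$ (i, i)"
    using F T by (simp add: assoc_mult_mat[of F n k ?T k])
  also have "\<dots> = row F i \<bullet> col (?T * F\<^sup>T) i" using F T i by simp
  also have "col (?T * F\<^sup>T) i = ?T *\<^sub>v y"
    using F T i by (subst col_mult2[of _ k k _ n]) (auto simp: y_def)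
  finally have diag: "(F * ?T * F\<^sup>T) $$ (i, i) = y \<bullet> (?T *\<^sub>v y)" by (simp add: y_def)
  have qi: "q $ i = y \<bullet> (?T *\<^sub>v y)" using F i by (simp add: q_def y_def)
  have "(q $ i)\<^sup>2 \<le> q \<bullet> q"
    unfolding scalar_prod_def using q i
    by (simp add: power2_eq_square) (rule member_le_sum, auto)
  also have "q \<bullet> q = (?T *\<^sub>v y) \<bullet> (?G *\<^sub>v (?T *\<^sub>v y))"
    using gram_quadratic_form[OF F Ty] by (simp add: q_def G)
  also have "\<dots> = y \<bullet> (?T *\<^sub>v (?G *\<^sub>v (?T *\<^sub>v y)))"
    using transpose_vec_mult_scalar[OF T _ y, of "?G *\<^sub>v (?T *\<^sub>v y)"] Gc Ty T y
    by (simp add: orth_conj_transpose[OF U] comm_scalar_prod[of _ k])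
  \<comment> \<open>All three factors share \<open>U\<close>, so their product has the diagonal
    \<theta>_j^2 g_j.\<close>
  also have "?T *\<^sub>v (?G *\<^sub>v (?T *\<^sub>v y)) = orth_conj U (\<lambda>j. \<theta> j * (g j * \<theta> j)) *\<^sub>v y"
    using T Gc y Ty by (simp flip: orth_conj_mult[OF U orth]
        add: assoc_mult_mat_vec[of _ k k _ k] mult_carrier_mat[of _ k k _ k])
  also have "y \<bullet> \<dots> = (\<Sum>j<k. \<theta> j * (g j * \<theta> j) * ((U\<^sup>T *\<^sub>v y) $ j)\<^sup>2)"
    by (rule orth_conj_quadratic_form[OF U y])
  \<comment> \<open>Multiplying \<open>\<theta> j * g j \<le> 1\<close> by the nonnegative
    \<open>\<theta> j\<close> compares T G T with T; this is the source of P^2 \<le> P.\<close>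
  also have "\<dots> \<le> (\<Sum>j<k. \<theta> j * ((U\<^sup>T *\<^sub>v y) $ j)\<^sup>2)"
  proof (intro sum_mono mult_right_mono)
    fix j assume "j \<in> {..<k}"
    then have "0 \<le> \<theta> j" "\<theta> j * g j \<le> 1" using bound by auto
    then have "\<theta> j * (\<theta> j * g j) \<le> \<theta> j * 1" by (intro mult_left_mono)
    then show "\<theta> j * (g j * \<theta> j) \<le> \<theta> j" by (simp add: mult_ac)
  qed simp
  also have "\<dots> = q $ i" unfolding qi by (rule orth_conj_quadratic_form[OF U y, symmetric])
  finally have "(q $ i)\<^sup>2 \<le> q $ i" .
  then have "q $ i \<le> 1"
    using mult_le_cancel_left_pos[of "q $ i" "q $ i" 1] by (cases "0 < q $ i") (auto simp: power2_eq_square)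
  then show ?thesis by (simp add: diag qi)
qed

text \<open>As U (U^T x) = x, a nonzero \<open>x\<close> gives U^T x a nonzero coordinate, whose
  term makes the diagonal form positive.\<close>

lemma pd_orth_conj:
  assumes U: "U \<in> carrier_mat k k" and orth: "U * U\<^sup>T = 1\<^sub>m k"
    and pos: "\<And>i. i < k \<Longrightarrow> 0 < f i"
  shows "pd_mat (orth_conj U f)"
proof -
  have T: "orth_conj U f \<in> carrier_mat k k" using U by simp
  then have dim: "dim_row (orth_conj U f) = k" "dim_col (orth_conj U f) = k"
    by (blast dest: carrier_matD)+
  have "0 < x \<bullet> (orth_conj U f *\<^sub>v x)" if x: "x \<in> carrier_vec k" "x \<noteq> 0\<^sub>v k" for x
  proof -
    let ?z = "U\<^sup>T *\<^sub>v x"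
    have z: "?z \<in> carrier_vec k" using U x by simp
    have "U *\<^sub>v ?z = x"
      using assoc_mult_mat_vec[OF U, of "U\<^sup>T" k x] U x by (simp add: orth)
    moreover have "U *\<^sub>v 0\<^sub>v k = 0\<^sub>v k" using U by (intro eq_vecI) auto
    ultimately have "?z \<noteq> 0\<^sub>v k" using x(2) by metis
    then obtain i where i: "i < k" "?z $ i \<noteq> 0"
      using z by (metis carrier_vecD eq_vecI index_zero_vec)
    have "0 < (\<Sum>i<k. f i * (?z $ i)\<^sup>2)"
    proof (rule sum_pos2)
      show "0 < f i * (?z $ i)\<^sup>2" using i pos by simp
      show "0 \<le> f j * (?z $ j)\<^sup>2" if "j \<in> {..<k}" for j
        using that pos[of j] by simp
    qed (use i in auto)
    then show ?thesis by (simp only: orth_conj_quadratic_form[OF U x(1)])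
  qed
  then show ?thesis
    by (auto simp: pd_mat_def symmetric_mat_def dim orth_conj_transpose[OF U])
qed

theorem theorem2p5:
  fixes n s r :: nat and C :: "real mat"
  assumes "1 < n" and "0 < s" and "s < n"
    and "C \<in> carrier_mat n n" and "psd_mat C"
    and "r = vec_space.rank n C" and "s \<le> r"
  shows "\<forall>k F. r \<le> k \<and> k \<le> n \<and> F \<in> carrier_mat n k \<and> C = F * F\<^sup>T \<longrightarrow>
           z_dfact C s F \<le> ereal (\<Sum>l = 1..s. ln (eigval l C))"
proof (intro allI impI, elim conjE)
  fix k F
  assume "r \<le> k" "k \<le> n" and F: "F \<in> carrier_mat n k" and CF: "C = F * F\<^sup>T"
  note C = assms(4)
  have s: "0 < s" "s \<le> k" using assms(2,7) \<open>r \<le> k\<close> by auto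
  have Ct: "C\<^sup>T = C" using assms(5) by (simp add: psd_mat_def symmetric_mat_def)
  define g where "g = eigvals_desc (F\<^sup>T * F)"
  have G: "F\<^sup>T * F \<in> carrier_mat k k" using F by simp
  have Gt: "(F\<^sup>T * F)\<^sup>T = F\<^sup>T * F" using F by (simp add: transpose_mult[of _ k n])
  obtain U where U: "U \<in> carrier_mat k k" and orth: "U\<^sup>T * U = 1\<^sub>m k" "U * U\<^sup>T = 1\<^sub>m k"
    and GU: "F\<^sup>T * F = orth_conj U ((!) g)"
    using real_spectral_theorem[OF G Gt char_poly_eigvals_desc[OF G Gt]] unfolding g_def by blast
  have len: "length g = k" unfolding g_def by (rule length_eigvals_desc[OF G Gt])
  have C_g: "eigvals_desc C = g @ replicate (n - k) 0"
    unfolding CF g_def by (rule eigvals_desc_gram[OF F \<open>k \<le> n\<close>])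
  have mono: "g ! j \<le> g ! i" if "i \<le> j" "j < k" for i j
    using sorted_rev_nth_mono[of g i j] sorted_rev_eigvals_desc that len by (auto simp: g_def)
  have nonneg: "0 \<le> eigvals_desc C ! i" if "i < n" for i
    using eigvals_desc_nonneg[OF C Ct, of "eigvals_desc C ! i"] assms(5) C that
      length_eigvals_desc[OF C Ct] by (auto simp: psd_mat_def)
  \<comment> \<open>Entry \<open>s - 1\<close> of the list, counted from 0, is the s-th eigenvalue.
    Were it not positive, monotonicity, nonnegativity and the zero padding would make all
    eigenvalues of \<open>C\<close> from there on vanish, forcing rank at most
    \<open>s - 1\<close>.\<close>
  have pos: "0 < g ! (s - 1)"
  proof (rule ccontr)
    assume neg: "\<not> 0 < g ! (s - 1)"
    have "eigvals_desc C ! i = 0" if i: "s - 1 \<le> i" "i < n" for i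
    proof (cases "i < k")
      case True
      then have "eigvals_desc C ! i \<le> 0"
        using mono[OF i(1) True] neg by (simp add: C_g nth_append len)
      then show ?thesis using nonneg[OF i(2)] by simp
    next
      case False
      then show ?thesis using i by (simp add: C_g nth_append len)
    qed
    then have "r \<le> s - 1" unfolding assms(6) by (rule rank_symmetric_le[OF C Ct])
    then show False using assms(2,7) by simp
  qed
  \<comment> \<open>Capping the index at \<open>s - 1\<close> divides only by positive entries,
    although later ones may vanish. It keeps every \<theta>_i positive and the sequence
    nondecreasing on the indices below \<open>k\<close>.\<close>
  define \<theta> where "\<theta> i = 1 / g ! min i (s - 1)" for i
  have gmin: "0 < g ! min i (s - 1)" for i
  proof -
    have "g ! (s - 1) \<le> g ! min i (s - 1)" using s by (intro mono) auto
    then show ?thesis using pos by simp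
  qed
  have \<theta>_pos: "0 < \<theta> i" for i using gmin by (simp add: \<theta>_def)
  have \<theta>_bound: "0 \<le> \<theta> i \<and> \<theta> i * g ! i \<le> 1" if "i < k" for i
    using mono[of "min i (s - 1)" i] gmin[of i] that \<theta>_pos[of i] by (simp add: \<theta>_def)
  define T where "T = orth_conj U \<theta>"
  have T: "T \<in> carrier_mat k k" using U by (simp add: T_def)
  have "\<theta> i \<le> \<theta> j" if "i \<le> j" "j < k" for i j
    unfolding \<theta>_def using that mono[of "min i (s - 1)" "min j (s - 1)"] gmin s
    by (intro divide_left_mono) auto
  \<comment> \<open>Since \<theta> is nondecreasing, its reversal is already the decreasing list of
    eigenvalues of \<open>T\<close>.\<close>
  then have "sorted (map \<theta> [0..<k])"
    by (auto simp: sorted_iff_nth_mono)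
  then have eig_T: "eigvals_desc T = rev (map \<theta> [0..<k])"
    unfolding T_def by (intro eigvals_desc_eqI)
      (simp_all add: char_poly_orth_conj[OF U orth] proots_linear_factors del: map_map)
  \<comment> \<open>The \<open>s\<close> smallest eigenvalues of \<open>T\<close> are the first
    \<open>s\<close> values of \<theta>; the map l \<mapsto> k + 1 - l matches the two
    ranges.\<close>
  have "(\<Sum>l = k - s + 1..k. ln (eigval l T)) = (\<Sum>l = 1..s. ln (\<theta> (l - 1)))"
  proof (rule sum.reindex_bij_witness[of _ "\<lambda>l. k + 1 - l" "\<lambda>l. k + 1 - l"])
    fix l assume "l \<in> {k - s + 1..k}"
    then have "l - 1 < k" "k - Suc (l - 1) = k - l" by auto
    then show "ln (\<theta> (k + 1 - l - 1)) = ln (eigval l T)"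
      by (simp add: eigval_def eig_T rev_nth)
  qed (use s in auto)
  \<comment> \<open>In this range the cap is inactive and the index stays short of the zero padding,
    so \<theta> takes the reciprocal of the l-th eigenvalue of \<open>C\<close>.\<close>
  also have "\<dots> = (\<Sum>l = 1..s. - ln (eigval l C))"
  proof (rule sum.cong)
    fix l assume "l \<in> {1..s}"
    then have l: "min (l - 1) (s - 1) = l - 1" "l - 1 < k" using s by auto
    show "ln (\<theta> (l - 1)) = - ln (eigval l C)"
      using gmin[of "l - 1"] l by (simp add: \<theta>_def eigval_def C_g nth_append len ln_div)
  qed simp
  \<comment> \<open>With \<nu> = 0 and \<tau> = 1 the terms \<tau> s and -s cancel, and every choice
    of \<upsilon> gives the same value.\<close>
  finally have obj: "dfact_objective s (T, \<upsilon>, 0\<^sub>v n, 1) = (\<Sum>l = 1..s. ln (eigval l C))" for \<upsilon>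
    using T by (simp add: dfact_objective_def ones_vec_def sum_negf)
  \<comment> \<open>The equality constraint forces this slack; the diagonal bound makes it
    nonnegative.\<close>
  define \<upsilon> where "\<upsilon> = ones_vec n - diag_vec (F * T * F\<^sup>T)"
  have dim: "dim_row (F * T * F\<^sup>T) = n" "dim_vec (diag_vec (F * T * F\<^sup>T)) = n" "dim_vec \<upsilon> = n"
    using F by (auto simp: \<upsilon>_def diag_vec_def)
  have "0\<^sub>v n \<le> \<upsilon>"
    using diag_congruence_le_1[OF F U orth(1) GU \<theta>_bound] dim
    by (auto simp: less_eq_vec_def \<upsilon>_def ones_vec_def diag_vec_def T_def)
  moreover have "diag_vec (F * T * F\<^sup>T) + \<upsilon> - 0\<^sub>v n - 1 \<cdot>\<^sub>v ones_vec n = 0\<^sub>v n"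
    using dim by (auto simp: vec_eq_iff \<upsilon>_def ones_vec_def)
  ultimately have "(T, \<upsilon>, 0\<^sub>v n, 1) \<in> dfact_feasible C F"
    using C F T dim pd_orth_conj[of U k \<theta>, OF U orth(2) \<theta>_pos, folded T_def]
    by (auto simp: dfact_feasible_def intro: carrier_vecI)
  then show "z_dfact C s F \<le> ereal (\<Sum>l = 1..s. ln (eigval l C))"
    unfolding z_dfact_def obj[of \<upsilon>, symmetric] by (rule INF_lower)
qed

end
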